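(* There is a constant $C$ such that every 2-program $P$ with $n$ atoms has at most $C\times 3^{n/3}$ stable models.
   Context: A clause is $p\leftarrow B$ or $\leftarrow B$ (a constraint), where $p$ is an atom and $B$ is a finite set of literals (atoms $a$ or negated atoms $\mathrm{not}(a)$). A propositional logic program is a finite set of clauses; it is a 2-program if every clause has at most 2 literals, counting the head. $M\subseteq\mathit{At}(P)$ (the set of atoms of $P$) is a stable model of $P$ if $M$ satisfies all constraints of $P$ and is the least model of the Gelfond–Lifschitz reduct $P^M$, obtained by deleting every non-constraint clause with some $\mathrm{not}(a)$, $a\in M$, in its body and deleting negated literals from the remaining non-constraint clauses. *)

theory Defs
  imports Complex_Main
begin

datatype 'a lit = Pos 'a | Neg 'a

fun lit_atom :: "'a lit \<Rightarrow> 'a" where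
  "lit_atom (Pos a) = a"
| "lit_atom (Neg a) = a"

text \<open>The head \<open>None\<close> represents a constraint.\<close>

datatype 'a clause = Clause (head: "'a option") (body: "'a lit set")

type_synonym 'a program = "'a clause set"

definition logic_program :: "'a program \<Rightarrow> bool" where
  "logic_program P \<longleftrightarrow> finite P \<and> (\<forall>c\<in>P. finite (body c))"

definition clause_atoms :: "'a clause \<Rightarrow> 'a set" where
  "clause_atoms c = set_option (head c) \<union> lit_atom ` body c"

definition At :: "'a program \<Rightarrow> 'a set" where
  "At P = (\<Union>c\<in>P. clause_atoms c)"

text \<open>The head counts as a separate literal occurrence even if it also occurs in the body.\<close>

definition num_lits :: "'a clause \<Rightarrow> nat" where
  "num_lits c = card (set_option (head c)) + card (body c)"

definition two_program :: "'a program \<Rightarrow> bool" where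
  "two_program P \<longleftrightarrow> logic_program P \<and> (\<forall>c\<in>P. num_lits c \<le> 2)"

fun sat_lit :: "'a set \<Rightarrow> 'a lit \<Rightarrow> bool" where
  "sat_lit M (Pos a) \<longleftrightarrow> a \<in> M"
| "sat_lit M (Neg a) \<longleftrightarrow> a \<notin> M"

definition sat_clause :: "'a set \<Rightarrow> 'a clause \<Rightarrow> bool" where
  "sat_clause M c \<longleftrightarrow> ((\<forall>l\<in>body c. sat_lit M l) \<longrightarrow> (\<exists>p. head c = Some p \<and> p \<in> M))"

definition is_model :: "'a set \<Rightarrow> 'a program \<Rightarrow> bool" where
  "is_model M P \<longleftrightarrow> (\<forall>c\<in>P. sat_clause M c)"

definition least_model :: "'a set \<Rightarrow> 'a program \<Rightarrow> bool" where
  "least_model M P \<longleftrightarrow> is_model M P \<and> (\<forall>N. is_model N P \<longrightarrow> M \<subseteq> N)"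

definition constraints :: "'a program \<Rightarrow> 'a program" where
  "constraints P = {c \<in> P. head c = None}"

text \<open>
  The reduct contains no constraints, so it is a definite Horn program; keeping them would
  let a constraint support an atom by excluding the smaller models.
\<close>

definition reduct :: "'a program \<Rightarrow> 'a set \<Rightarrow> 'a program" where
  "reduct P M = {Clause (head c) (body c - range Neg) | c.
     c \<in> P \<and> head c \<noteq> None \<and> (\<forall>a\<in>M. Neg a \<notin> body c)}"

definition stable_model :: "'a program \<Rightarrow> 'a set \<Rightarrow> bool" where
  "stable_model P M \<longleftrightarrow>
     M \<subseteq> At P \<and> is_model M (constraints P) \<and> least_model M (reduct P M)"

lemma finite_At: "logic_program P \<Longrightarrow> finite (At P)"
  by (auto simp: logic_program_def At_def clause_atoms_def)

text \<open>The cardinalities of \<open>At P\<close> and of the set of stable models are therefore genuine.\<close>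

lemma finite_stable_models: "logic_program P \<Longrightarrow> finite {M. stable_model P M}"
  by (rule finite_subset[of _ "Pow (At P)"]) (auto simp: stable_model_def finite_At)

end

theory Submission
  imports Defs
begin

text \<open>
  A rule of a 2-program is a fact, a positive edge \<open>p \<leftarrow> q\<close> or a negative edge \<open>p \<leftarrow> not q\<close>.
  Hence the least model of the reduct consists of the atoms reachable along positive edges
  from a fact or from the head of some \<open>s \<leftarrow> not q\<close> with \<open>q\<close> false. Say that \<open>p\<close> conflicts with
  \<open>q\<close> if \<open>p\<close> is reachable from the head of such a rule. Then the complement of a stable model is
  a kernel of the conflict relation on the atoms not derivable from facts, and so a maximal
  independent set of the underlying simple graph. By the theorem of Moon and Moser a graph
  with \<open>n\<close> vertices has at most \<open>3 powr (n / 3)\<close> of these, so \<open>C = 1\<close> works.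
\<close>

section \<open>Counting maximal independent sets of a graph\<close>

text \<open>One equivalence encodes both properties: left to right is independence, right to left is
  maximality, as a vertex without neighbour in \<open>N\<close> could be added.\<close>

definition maximal_independent_sets :: "('a \<Rightarrow> 'a \<Rightarrow> bool) \<Rightarrow> 'a set \<Rightarrow> 'a set set" where
  "maximal_independent_sets E V = {N. N \<subseteq> V \<and> (\<forall>x\<in>V. x \<in> N \<longleftrightarrow> \<not> (\<exists>y\<in>N. E x y))}"

lemma finite_maximal_independent_sets:
  "finite V \<Longrightarrow> finite (maximal_independent_sets E V)"
  by (rule finite_subset[of _ "Pow V"]) (auto simp: maximal_independent_sets_def)

text \<open>Deleting \<open>u\<close> is injective on sets containing \<open>u\<close>. Independence
  keeps the rest of \<open>N\<close> off the neighbours of \<open>u\<close>, and the remaining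
  vertices are not dominated by \<open>u\<close>, so \<open>N - {u}\<close> is still maximal
  there.\<close>

lemma card_maximal_independent_sets_containing:
  assumes "finite V" "symp E" "irreflp E"
  shows "card {N \<in> maximal_independent_sets E V. u \<in> N}
    \<le> card (maximal_independent_sets E (V - insert u {y. E u y}))"
proof (rule card_inj_on_le[where f = "\<lambda>N. N - {u}"])
  show "inj_on (\<lambda>N. N - {u}) {N \<in> maximal_independent_sets E V. u \<in> N}"
    by (rule inj_onI) (simp, metis insert_Diff)
  show "(\<lambda>N. N - {u}) ` {N \<in> maximal_independent_sets E V. u \<in> N}
      \<subseteq> maximal_independent_sets E (V - insert u {y. E u y})"
  proof clarify
    fix N assume N: "N \<in> maximal_independent_sets E V" "u \<in> N"
    have max: "N \<subseteq> V" "\<And>x. x \<in> V \<Longrightarrow> x \<in> N \<longleftrightarrow> \<not> (\<exists>y\<in>N. E x y)"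
      using N(1) by (auto simp: maximal_independent_sets_def)
    have "\<not> E u y" if "y \<in> N" for y
      using max N(2) that by blast
    moreover have "\<not> E x u" if "\<not> E u x" for x
      using that sympD[OF assms(2)] by blast
    ultimately show "N - {u} \<in> maximal_independent_sets E (V - insert u {y. E u y})"
      using max unfolding maximal_independent_sets_def by blast
  qed
qed (use assms(1) in \<open>simp add: finite_maximal_independent_sets\<close>)

lemma of_nat_le_three_powr: "real k \<le> 3 powr (real k / 3)"
proof -
  have cube: "k ^ 3 \<le> 3 ^ k"
  proof (cases "k < 3")
    case True
    then have "k = 0 \<or> k = 1 \<or> k = 2" by auto
    then show ?thesis by auto
  next
    case False
    then have "3 \<le> k" by simp
    then show ?thesis
    proof (induction k rule: dec_induct)
      case (step n)
      have "3 * (n * n) \<le> n * (n * n)" "3 * n \<le> n * n" "9 \<le> 3 * n"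
        using step by auto
      moreover have "n * (n * n) = n ^ 3" by (simp add: power3_eq_cube)
      moreover have "(Suc n) ^ 3 = n ^ 3 + 3 * (n * n) + 3 * n + 1"
        by (simp add: power3_eq_cube algebra_simps)
      ultimately have "(Suc n) ^ 3 \<le> 3 * n ^ 3" by linarith
      then show ?case using step.IH by simp
    qed simp
  qed
  have "real k ^ 3 \<le> (3 powr (real k / 3)) ^ 3"
  proof -
    have "(3 powr (real k / 3)) ^ 3 = 3 powr (real k)"
      by (simp add: powr_powr flip: powr_numeral)
    also have "\<dots> = real (3 ^ k)" by (simp add: powr_realpow)
    finally show ?thesis using cube by (metis of_nat_le_iff of_nat_power)
  qed
  \<comment> \<open>The rule compares powers with exponent \<open>Suc n\<close>, so
    \<open>n = 2\<close> takes cube roots.\<close>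
  then show ?thesis by (rule power_le_imp_le_base[of _ 2, simplified]) simp
qed

text \<open>Branch on which member of the smallest closed neighbourhood, of size \<open>k\<close>,
  lies in the set. Each of the \<open>k\<close> branches loses at least \<open>k\<close> vertices,
  and \<open>k \<le> 3 powr (k / 3)\<close> absorbs the factor \<open>k\<close>.\<close>

theorem card_maximal_independent_sets_le:
  assumes "finite V" "symp E" "irreflp E"
  shows "real (card (maximal_independent_sets E V)) \<le> 3 powr (real (card V) / 3)"
  using assms(1)
proof (induction "card V" arbitrary: V rule: less_induct)
  case less
  show ?case
  proof (cases "V = {}")
    case True
    then show ?thesis by (simp add: maximal_independent_sets_def)
  next
    case False
    define nbh where "nbh v = insert v {y \<in> V. E v y}" for v
    obtain v where v: "v \<in> V" and min: "\<And>u. u \<in> V \<Longrightarrow> card (nbh v) \<le> card (nbh u)"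
      using ex_has_least_nat[of "\<lambda>v. v \<in> V" _ "\<lambda>v. card (nbh v)"] False by blast
    define k where "k = card (nbh v)"
    have nbh_sub: "nbh u \<subseteq> V" if "u \<in> V" for u
      using that by (auto simp: nbh_def)
    have fin: "finite (nbh u)" if "u \<in> V" for u
      using nbh_sub[OF that] less.prems finite_subset by blast
    \<comment> \<open>Guards against truncated subtraction when \<open>card ?W\<close> is turned
      into a real number.\<close>
    have k_le: "k \<le> card V"
      unfolding k_def using nbh_sub[OF v] less.prems by (rule card_mono[rotated])
    have bound: "real (card {N \<in> maximal_independent_sets E V. u \<in> N})
        \<le> 3 powr ((real (card V) - real k) / 3)" if "u \<in> nbh v" for u
    proof -
      have u: "u \<in> V" using that nbh_sub[OF v] by blast
      let ?W = "V - insert u {y. E u y}"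
      have W: "?W = V - nbh u" by (auto simp: nbh_def)
      have card_W: "card ?W = card V - card (nbh u)"
        unfolding W by (rule card_Diff_subset[OF fin[OF u] nbh_sub[OF u]])
      have lt: "card ?W < card V"
        by (rule psubset_card_mono) (use u less.prems in auto)
      have "real (card ?W) \<le> real (card V) - real k"
        using card_W min[OF u] k_le k_def by linarith
      then have "3 powr (real (card ?W) / 3) \<le> 3 powr ((real (card V) - real k) / 3)"
        by simp
      then show ?thesis
        using less.hyps[OF lt finite_Diff[OF less.prems]]
          card_maximal_independent_sets_containing[OF less.prems assms(2,3), of u]
        by linarith
    qed
    \<comment> \<open>By maximality, \<open>N\<close> contains \<open>v\<close> or a neighbour of
      \<open>v\<close>.\<close>
    have "maximal_independent_sets E V
        \<subseteq> (\<Union>u\<in>nbh v. {N \<in> maximal_independent_sets E V. u \<in> N})"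
    proof
      fix N assume N: "N \<in> maximal_independent_sets E V"
      then have sub: "N \<subseteq> V" and max: "v \<in> N \<longleftrightarrow> \<not> (\<exists>y\<in>N. E v y)"
        using v by (auto simp: maximal_independent_sets_def)
      then obtain u where "u \<in> nbh v" "u \<in> N"
        by (auto simp: nbh_def)
      with N show "N \<in> (\<Union>u\<in>nbh v. {N \<in> maximal_independent_sets E V. u \<in> N})"
        by blast
    qed
    then have "card (maximal_independent_sets E V)
        \<le> card (\<Union>u\<in>nbh v. {N \<in> maximal_independent_sets E V. u \<in> N})"
      by (rule card_mono[rotated])
        (use fin[OF v] less.prems in \<open>simp add: finite_maximal_independent_sets\<close>)
    also have "\<dots> \<le> (\<Sum>u\<in>nbh v. card {N \<in> maximal_independent_sets E V. u \<in> N})"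
      by (rule card_UN_le[OF fin[OF v]])
    finally have "real (card (maximal_independent_sets E V))
        \<le> (\<Sum>u\<in>nbh v. real (card {N \<in> maximal_independent_sets E V. u \<in> N}))"
      by (metis of_nat_le_iff of_nat_sum)
    also have "\<dots> \<le> real k * 3 powr ((real (card V) - real k) / 3)"
      unfolding k_def by (rule sum_bounded_above) (use bound k_def in blast)
    also have "\<dots> \<le> 3 powr (real k / 3) * 3 powr ((real (card V) - real k) / 3)"
      by (intro mult_right_mono of_nat_le_three_powr) simp
    also have "\<dots> = 3 powr (real (card V) / 3)"
      by (simp add: powr_add[symmetric] add_divide_distrib[symmetric])
    finally show ?thesis .
  qed
qed

section \<open>Stable models of 2-programs as complements of independent sets\<close>

definition reaches :: "'a program \<Rightarrow> 'a \<Rightarrow> 'a \<Rightarrow> bool" where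
  "reaches P = (\<lambda>q p. Clause (Some p) {Pos q} \<in> P)\<^sup>*\<^sup>*"

definition fact_derived :: "'a program \<Rightarrow> 'a set" where
  "fact_derived P = {p. \<exists>s. Clause (Some s) {} \<in> P \<and> reaches P s p}"

text \<open>The relation is directed: falsity of \<open>q\<close> forces \<open>p\<close>. It may
  contain loops.\<close>

definition conflict :: "'a program \<Rightarrow> 'a \<Rightarrow> 'a \<Rightarrow> bool" where
  "conflict P p q \<longleftrightarrow> (\<exists>s. Clause (Some s) {Neg q} \<in> P \<and> reaches P s p)"

lemma two_program_rule_cases:
  assumes "two_program P" "Clause (Some p) B \<in> P"
  obtains "B = {}" | q where "B = {Pos q}" | q where "B = {Neg q}"
proof -
  have "finite B" "card B \<le> 1"
    using assms by (force simp: two_program_def logic_program_def num_lits_def)+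
  then consider "B = {}" | l where "B = {l}"
    by (metis card_0_eq card_1_singletonE le_neq_implies_less less_one)
  then show thesis
    using that by (metis lit.exhaust)
qed

text \<open>Positive edges survive in every reduct, and \<open>M\<close> is a model of its own
  reduct.\<close>

lemma stable_model_closed:
  assumes M: "stable_model P M" and s: "s \<in> M" "reaches P s p"
  shows "p \<in> M"
  using s(2) unfolding reaches_def
proof (induction rule: rtranclp_induct)
  case base
  show ?case by (rule s(1))
next
  case (step q p)
  then have "Clause (Some p) {Pos q} \<in> reduct P M"
    by (force simp: reduct_def)
  with M step.IH show ?case
    by (fastforce simp: stable_model_def least_model_def is_model_def sat_clause_def)
qed

text \<open>The right side is a model of the reduct, so it includes the least model
  \<open>M\<close>. Conversely, its starting atoms are facts of the reduct, and \<open>M\<close> is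
  closed under positive edges.\<close>

lemma stable_model_eq:
  assumes P: "two_program P" and M: "stable_model P M"
  shows "M = fact_derived P \<union> {p. \<exists>q. q \<notin> M \<and> conflict P p q}" (is "M = ?T")
proof
  have "is_model ?T (reduct P M)"
    unfolding is_model_def
  proof
    fix r assume "r \<in> reduct P M"
    then obtain p B where c: "Clause (Some p) B \<in> P" "\<forall>a\<in>M. Neg a \<notin> B"
      and r: "r = Clause (Some p) (B - range Neg)"
      unfolding reduct_def by clarsimp (metis clause.collapse)
    from P c(1) show "sat_clause ?T r"
    proof (cases rule: two_program_rule_cases)
      case 1
      with c have "p \<in> ?T" by (auto simp: fact_derived_def reaches_def)
      then show ?thesis by (simp add: r sat_clause_def)
    next
      case (2 q)
      have "reaches P s p" if "reaches P s q" for s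
        using that c(1) 2 unfolding reaches_def by (simp add: rtranclp.rtrancl_into_rtrancl)
      then have "p \<in> ?T" if "q \<in> ?T"
        using that by (auto simp: fact_derived_def conflict_def)
      moreover have "r = Clause (Some p) {Pos q}" using 2 r by auto
      ultimately show ?thesis by (simp add: sat_clause_def)
    next
      case (3 q)
      with c have "p \<in> ?T" by (auto simp: conflict_def reaches_def)
      then show ?thesis by (simp add: r sat_clause_def)
    qed
  qed
  with M show "M \<subseteq> ?T" by (simp add: stable_model_def least_model_def)
next
  have source: "s \<in> M" if "Clause (Some s) B \<in> P" "B = {} \<or> (\<exists>q. q \<notin> M \<and> B = {Neg q})" for s B
  proof -
    have "Clause (Some s) {} \<in> reduct P M"
      using that by (force simp: reduct_def)
    with M show ?thesis
      by (fastforce simp: stable_model_def least_model_def is_model_def sat_clause_def)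
  qed
  then show "?T \<subseteq> M"
    by (auto simp: fact_derived_def conflict_def intro: stable_model_closed[OF M])
qed

lemma card_stable_models_le:
  assumes P: "two_program P"
  shows "real (card {M. stable_model P M}) \<le> 3 powr (real (card (At P)) / 3)"
proof -
  \<comment> \<open>Symmetrising and dropping loops gives the simple graph required by the counting
    bound.\<close>
  define E where "E x y \<longleftrightarrow> x \<noteq> y \<and> (conflict P x y \<or> conflict P y x)" for x y
  have fin: "finite (At P)"
    using P by (simp add: two_program_def finite_At)
  have At: "q \<in> At P" if "conflict P p q" for p q
    using that by (force simp: conflict_def At_def clause_atoms_def)
  let ?V = "At P - fact_derived P"
  have "card {M. stable_model P M} \<le> card (maximal_independent_sets E ?V)"
  proof (rule card_inj_on_le[where f = "\<lambda>M. At P - M"])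
    show "inj_on (\<lambda>M. At P - M) {M. stable_model P M}"
      by (rule inj_onI) (auto simp: stable_model_def)
    show "(\<lambda>M. At P - M) ` {M. stable_model P M} \<subseteq> maximal_independent_sets E ?V"
    proof clarify
      fix M assume M: "stable_model P M"
      have eq: "x \<in> M \<longleftrightarrow> x \<in> fact_derived P \<or> (\<exists>q. q \<notin> M \<and> conflict P x q)" for x
        using stable_model_eq[OF P M] by blast
      have "At P - M \<subseteq> ?V" using eq by blast
      moreover have "x \<in> At P - M \<longleftrightarrow> \<not> (\<exists>y\<in>At P - M. E x y)" if x: "x \<in> ?V" for x
      proof (cases "x \<in> M")
        case True
        \<comment> \<open>As \<open>x\<close> is not derived from facts, only a false
          \<open>q\<close> can support it; \<open>q\<close> differs from \<open>x\<close> because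
          \<open>x\<close> is true.\<close>
        then obtain q where "q \<notin> M" "conflict P x q" using eq[of x] x by blast
        with True have "q \<in> At P - M" "E x q" using At by (auto simp: E_def)
        with True show ?thesis by blast
      next
        case False
        \<comment> \<open>A conflict between two false atoms, in either direction, would make one of
          them true.\<close>
        have "\<not> E x y" if "y \<notin> M" for y
          using False that eq[of x] eq[of y] unfolding E_def by blast
        then show ?thesis using False x by blast
      qed
      ultimately show "At P - M \<in> maximal_independent_sets E ?V"
        by (simp add: maximal_independent_sets_def)
    qed
  qed (use fin in \<open>simp add: finite_maximal_independent_sets\<close>)
  then have "real (card {M. stable_model P M}) \<le> real (card (maximal_independent_sets E ?V))"
    by simp
  also have "\<dots> \<le> 3 powr (real (card ?V) / 3)"
    using fin by (intro card_maximal_independent_sets_le) (auto simp: E_def symp_def irreflp_def)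
  also have "\<dots> \<le> 3 powr (real (card (At P)) / 3)"
    using fin by (simp add: card_mono)
  finally show ?thesis .
qed

theorem theorem6:
  "\<exists>C::real. \<forall>P :: 'a program. two_program P \<longrightarrow>
     real (card {M. stable_model P M}) \<le> C * 3 powr (real (card (At P)) / 3)"
  using card_stable_models_le by (metis mult_1)

end
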